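(* Let $\mathbf{R}:(\mathbb{C}^2)^3\to(\mathbb{C}^2)^3$ be the rational map $$\mathbf{R}:\left(\begin{pmatrix}x_1\\ {y_1}\end{pmatrix},\begin{pmatrix}x_2\\ {y_2}\end{pmatrix},\begin{pmatrix}x_3\\ {y_3}\end{pmatrix}\right)\mapsto\left(\begin{pmatrix}\frac{x_1x_2}{x_1+x_3}\\[2pt] \frac{(x_1+x_3)y_1y_2}{x_1y_1+x_3y_3}\end{pmatrix},\begin{pmatrix}x_1+x_3\\[2pt] \frac{x_1y_1+x_3y_3}{x_1+x_3}\end{pmatrix},\begin{pmatrix}\frac{x_2x_3}{x_1+x_3}\\[2pt] \frac{(x_1+x_3)y_2y_3}{x_1y_1+x_3y_3}\end{pmatrix}\right),$$ and let $\mathbf{J}:(\mathbb{C}^2)^4\to(\mathbb{C}^2)^4$ be the rational map $$\mathbf{J}:\left(\begin{pmatrix}x_1\\ {y_1}\end{pmatrix},\begin{pmatrix}x_2\\ {y_2}\end{pmatrix},\begin{pmatrix}x_3\\ {y_3}\end{pmatrix},\begin{pmatrix}x_4\\ {y_4}\end{pmatrix}\right)\mapsto\left(\begin{pmatrix}\frac{x_1x_2^2x_3}{z_1}\\[2pt] \frac{y_1y_2^2y_3z_1}{w_1}\end{pmatrix},\begin{pmatrix}\frac{z_1}{z_2}\\[2pt] \frac{z_2w_1}{z_1w_2}\end{pmatrix},\begin{pmatrix}\frac{z_2^2}{z_1}\\[2pt] \frac{z_1w_2^2}{z_2^2w_1}\end{pmatrix},\begin{pmatrix}\frac{x_2x_3x_4}{z_2}\\[2pt]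 \frac{y_2y_3y_4z_2}{w_2}\end{pmatrix}\right),$$ where $$z_1=x_1(x_2+x_4)^2+x_3x_4^2,\quad z_2=x_1(x_2+x_4)+x_3x_4,$$ $$w_1=x_1y_1(x_2y_2+x_4y_4)^2+x_3x_4^2y_3y_4^2,\quad w_2=x_1y_1(x_2y_2+x_4y_4)+x_3x_4y_3y_4.$$ Then $(\mathbf{R},\mathbf{J})$ satisfies the 3D reflection equation: as rational maps on $(\mathbb{C}^2)^9$ (generic variables), $$\mathbf{R}_{489}\mathbf{J}_{3579}\mathbf{R}_{269}\mathbf{R}_{258}\mathbf{J}_{1678}\mathbf{J}_{1234}\mathbf{R}_{456}=\mathbf{R}_{456}\mathbf{J}_{1234}\mathbf{J}_{1678}\mathbf{R}_{258}\mathbf{R}_{269}\mathbf{J}_{3579}\mathbf{R}_{489}.$$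
   Context: Products of maps denote composition (the rightmost map is applied first). Write a point of $(\mathbb{C}^2)^9$ as $(v_1,\dots,v_9)$ with $v_i\in\mathbb{C}^2$. For $i<j<k$, $\mathbf{R}_{ijk}$ acts as $\mathbf{R}$ on the components $(v_i,v_j,v_k)$ and as the identity on the others; for $i<j<k<l$, $\mathbf{J}_{ijkl}$ acts as $\mathbf{J}$ on $(v_i,v_j,v_k,v_l)$ and as the identity on the others. All variables are assumed generic: the equation is an identity of (compositions of) rational maps. *)

theory Defs
  imports "HOL-Analysis.Analysis"
begin

text \<open>
  A rational map is represented by a partial function on the complement of the zero locus
  of the displayed denominators; elsewhere the value is \<^term>\<open>None\<close>, so that \<open>x / 0 = 0\<close>
  plays no role. Composition of representatives is \<^const>\<open>map_comp\<close>: \<open>f \<circ>\<^sub>m g\<close>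
  applies \<open>g\<close> first and is defined where \<open>g\<close> is defined with value in the domain of \<open>f\<close>.

  Points of \<open>(\<complex>\<^sup>2)\<^sup>9\<close> have type \<open>(complex \<times> complex) ^ 9\<close>. In the index type \<open>9\<close> arithmetic is
  modulo 9, so \<open>1, \<dots>, 9\<close> are its nine distinct elements (with \<open>9 = 0\<close>).
\<close>

type_synonym vec2 = "complex \<times> complex"

definition R_map :: "vec2 \<times> vec2 \<times> vec2 \<rightharpoonup> vec2 \<times> vec2 \<times> vec2" where
  "R_map = (\<lambda>((x1, y1), (x2, y2), (x3, y3)).
     if x1 + x3 \<noteq> 0 \<and> x1 * y1 + x3 * y3 \<noteq> 0 then
       Some ((x1 * x2 / (x1 + x3), (x1 + x3) * y1 * y2 / (x1 * y1 + x3 * y3)),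
             (x1 + x3, (x1 * y1 + x3 * y3) / (x1 + x3)),
             (x2 * x3 / (x1 + x3), (x1 + x3) * y2 * y3 / (x1 * y1 + x3 * y3)))
     else None)"

definition J_map :: "vec2 \<times> vec2 \<times> vec2 \<times> vec2 \<rightharpoonup> vec2 \<times> vec2 \<times> vec2 \<times> vec2" where
  "J_map = (\<lambda>((x1, y1), (x2, y2), (x3, y3), (x4, y4)).
     let z1 = x1 * (x2 + x4)\<^sup>2 + x3 * x4\<^sup>2;
         z2 = x1 * (x2 + x4) + x3 * x4;
         w1 = x1 * y1 * (x2 * y2 + x4 * y4)\<^sup>2 + x3 * x4\<^sup>2 * y3 * y4\<^sup>2;
         w2 = x1 * y1 * (x2 * y2 + x4 * y4) + x3 * x4 * y3 * y4
     in if z1 \<noteq> 0 \<and> z2 \<noteq> 0 \<and> w1 \<noteq> 0 \<and> w2 \<noteq> 0 then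
       Some ((x1 * x2\<^sup>2 * x3 / z1, y1 * y2\<^sup>2 * y3 * z1 / w1),
             (z1 / z2, z2 * w1 / (z1 * w2)),
             (z2\<^sup>2 / z1, z1 * w2\<^sup>2 / (z2\<^sup>2 * w1)),
             (x2 * x3 * x4 / z2, y2 * y3 * y4 * z2 / w2))
     else None)"

text \<open>The indices in \<open>act3\<close> and \<open>act4\<close> are meant to be pairwise distinct.\<close>

definition act3 ::
  "('a \<times> 'a \<times> 'a \<rightharpoonup> 'a \<times> 'a \<times> 'a) \<Rightarrow> 'n \<Rightarrow> 'n \<Rightarrow> 'n \<Rightarrow> 'a ^ 'n \<rightharpoonup> 'a ^ 'n" where
  "act3 f i j k v =
     map_option
       (\<lambda>(a, b, c). \<chi> m. if m = i then a else if m = j then b else if m = k then c else v $ m)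
       (f (v $ i, v $ j, v $ k))"

definition act4 ::
  "('a \<times> 'a \<times> 'a \<times> 'a \<rightharpoonup> 'a \<times> 'a \<times> 'a \<times> 'a) \<Rightarrow>
   'n \<Rightarrow> 'n \<Rightarrow> 'n \<Rightarrow> 'n \<Rightarrow> 'a ^ 'n \<rightharpoonup> 'a ^ 'n" where
  "act4 f i j k l v =
     map_option
       (\<lambda>(a, b, c, d). \<chi> m. if m = i then a else if m = j then b
                            else if m = k then c else if m = l then d else v $ m)
       (f (v $ i, v $ j, v $ k, v $ l))"

abbreviation R_on :: "'n \<Rightarrow> 'n \<Rightarrow> 'n \<Rightarrow> vec2 ^ 'n \<rightharpoonup> vec2 ^ 'n" where
  "R_on \<equiv> act3 R_map"

abbreviation J_on :: "'n \<Rightarrow> 'n \<Rightarrow> 'n \<Rightarrow> 'n \<Rightarrow> vec2 ^ 'n \<rightharpoonup> vec2 ^ 'n" where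
  "J_on \<equiv> act4 J_map"

text \<open>The polynomial functions over \<open>\<complex>\<close> in the coordinates \<open>x\<^sub>i = fst (v $ i)\<close>, \<open>y\<^sub>i = snd (v $ i)\<close>.\<close>

inductive_set polynomial_funs :: "(vec2 ^ 'n \<Rightarrow> complex) set" where
  const: "(\<lambda>v. c) \<in> polynomial_funs"
| coord_x: "(\<lambda>v. fst (v $ i)) \<in> polynomial_funs"
| coord_y: "(\<lambda>v. snd (v $ i)) \<in> polynomial_funs"
| add: "p \<in> polynomial_funs \<Longrightarrow> q \<in> polynomial_funs \<Longrightarrow> (\<lambda>v. p v + q v) \<in> polynomial_funs"
| mult: "p \<in> polynomial_funs \<Longrightarrow> q \<in> polynomial_funs \<Longrightarrow> (\<lambda>v. p v * q v) \<in> polynomial_funs"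

definition zariski_open :: "(vec2 ^ 'n) set \<Rightarrow> bool" where
  "zariski_open U \<longleftrightarrow> (\<exists>P \<subseteq> polynomial_funs. U = {v. \<exists>p\<in>P. p v \<noteq> 0})"

text \<open>
  Equality as rational maps: both representatives are defined and agree on a common nonempty
  Zariski-open set, which is dense because affine space is irreducible. Since both sides must be
  defined there, the equality of two composites includes the claim that these composites exist
  as rational maps.
\<close>

definition rational_map_eq ::
  "(vec2 ^ 'n \<rightharpoonup> vec2 ^ 'n) \<Rightarrow> (vec2 ^ 'n \<rightharpoonup> vec2 ^ 'n) \<Rightarrow> bool" where
  "rational_map_eq f g \<longleftrightarrow>
     (\<exists>U. zariski_open U \<and> U \<noteq> {} \<and> U \<subseteq> dom f \<inter> dom g \<and> (\<forall>v\<in>U. f v = g v))"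

end

theory Submission
  imports Defs
begin

text \<open>
  In the coordinates \<open>(x, u) = (x, x y)\<close> both maps decouple: \<open>x\<close> and \<open>u\<close> are transformed
  independently by one and the same pair of scalar maps. The scalar reflection equation is checked
  by following a generic point through both composites: every coordinate of every intermediate point
  is a Laurent monomial in the initial coordinates and a small family of polynomials
  \<open>p1, \<dots>, p20\<close>, because each sum occurring in a denominator factors into such polynomials.
\<close>

section \<open>Scalar maps\<close>

text \<open>
  All inputs are required to be nonzero, so that \<open>y = u / x\<close> can be recovered after each step.
\<close>

definition r_on :: "'n \<Rightarrow> 'n \<Rightarrow> 'n \<Rightarrow> ('n \<Rightarrow> complex) \<rightharpoonup> ('n \<Rightarrow> complex)" where
  "r_on i j k X =
     (let s = X i + X k in
      if X i \<noteq> 0 \<and> X j \<noteq> 0 \<and> X k \<noteq> 0 \<and> s \<noteq> 0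
      then Some (X(i := X i * X j / s, j := s, k := X j * X k / s))
      else None)"

definition j_on :: "'n \<Rightarrow> 'n \<Rightarrow> 'n \<Rightarrow> 'n \<Rightarrow> ('n \<Rightarrow> complex) \<rightharpoonup> ('n \<Rightarrow> complex)" where
  "j_on i j k l X =
     (let z1 = X i * (X j + X l)\<^sup>2 + X k * (X l)\<^sup>2; z2 = X i * (X j + X l) + X k * X l in
      if X i \<noteq> 0 \<and> X j \<noteq> 0 \<and> X k \<noteq> 0 \<and> X l \<noteq> 0 \<and> z1 \<noteq> 0 \<and> z2 \<noteq> 0
      then Some (X(i := X i * (X j)\<^sup>2 * X k / z1, j := z1 / z2, k := z2\<^sup>2 / z1,
                   l := X j * X k * X l / z2))
      else None)"

text \<open>Naming the entries and their sum separately lets each step of a composite supply the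
  factored form of its denominator; what remains is cancellation of monomials.\<close>

lemma r_on_eqI:
  assumes "X i = a" "X j = b" "X k = c" "a + c = s"
    and "a \<noteq> 0" "b \<noteq> 0" "c \<noteq> 0" "s \<noteq> 0"
    and "a' = a * b / s" "c' = b * c / s"
  shows "r_on i j k X = Some (X(i := a', j := s, k := c'))"
  using assms by (auto simp: r_on_def Let_def)

lemma j_on_eqI:
  assumes "X i = a" "X j = b" "X k = c" "X l = d"
    and "b + d = e" "a * e\<^sup>2 + c * d\<^sup>2 = z1" "a * e + c * d = z2"
    and "a \<noteq> 0" "b \<noteq> 0" "c \<noteq> 0" "d \<noteq> 0" "z1 \<noteq> 0" "z2 \<noteq> 0"
    and "a' = a * b\<^sup>2 * c / z1" "b' = z1 / z2" "c' = z2\<^sup>2 / z1" "d' = b * c * d / z2"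
  shows "j_on i j k l X = Some (X(i := a', j := b', k := c', l := d'))"
  using assms by (auto simp: j_on_def Let_def)

section \<open>Separation of the x- and u-coordinates\<close>

text \<open>Inverse of the coordinate change from \<open>(x, y)\<close> to \<open>(x, x * y)\<close>
  wherever no \<open>X m\<close> vanishes.\<close>

definition join :: "('n \<Rightarrow> complex) \<Rightarrow> ('n \<Rightarrow> complex) \<Rightarrow> vec2 ^ 'n" where
  "join X U = (\<chi> m. (X m, U m / X m))"

text \<open>An implication rather than an equality of partial maps, because the scalar maps have
  smaller domains: they also demand nonzero inputs.\<close>

definition decouples ::
  "(vec2 ^ 'n \<rightharpoonup> vec2 ^ 'n) \<Rightarrow> (('n \<Rightarrow> complex) \<rightharpoonup> ('n \<Rightarrow> complex)) \<Rightarrow> bool" where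
  "decouples F f \<longleftrightarrow>
     (\<forall>X U X' U'. f X = Some X' \<longrightarrow> f U = Some U' \<longrightarrow> F (join X U) = Some (join X' U'))"

lemma decouples_comp:
  assumes "decouples F f" "decouples G g"
  shows "decouples (F \<circ>\<^sub>m G) (f \<circ>\<^sub>m g)"
  using assms unfolding decouples_def map_comp_Some_iff by blast

lemma decouples_r_on:
  assumes "distinct [i, j, k]"
  shows "decouples (R_on i j k) (r_on i j k)"
  unfolding decouples_def
proof (intro allI impI)
  fix X U X' U' :: "'a \<Rightarrow> complex"
  assume "r_on i j k X = Some X'" "r_on i j k U = Some U'"
  then show "R_on i j k (join X U) = Some (join X' U')"
    using assms
    by (auto simp: r_on_def act3_def R_map_def join_def Let_def vec_eq_iff mult_ac
        split: if_splits)
qed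

lemma decouples_j_on:
  assumes "distinct [i, j, k, l]"
  shows "decouples (J_on i j k l) (j_on i j k l)"
  unfolding decouples_def
proof (intro allI impI)
  fix X U X' U' :: "'a \<Rightarrow> complex"
  assume *: "j_on i j k l X = Some X'" "j_on i j k l U = Some U'"
  define z1 where "z1 = X i * (X j + X l)\<^sup>2 + X k * (X l)\<^sup>2"
  define z2 where "z2 = X i * (X j + X l) + X k * X l"
  define w1 where "w1 = U i * (U j + U l)\<^sup>2 + U k * (U l)\<^sup>2"
  define w2 where "w2 = U i * (U j + U l) + U k * U l"
  have X: "X i \<noteq> 0" "X j \<noteq> 0" "X k \<noteq> 0" "X l \<noteq> 0" "z1 \<noteq> 0" "z2 \<noteq> 0"
    "X' = X(i := X i * (X j)\<^sup>2 * X k / z1, j := z1 / z2, k := z2\<^sup>2 / z1,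
                   l := X j * X k * X l / z2)"
    using *(1) by (auto simp: j_on_def Let_def z1_def z2_def split: if_splits)
  have U: "U i \<noteq> 0" "U j \<noteq> 0" "U k \<noteq> 0" "U l \<noteq> 0" "w1 \<noteq> 0" "w2 \<noteq> 0"
    "U' = U(i := U i * (U j)\<^sup>2 * U k / w1, j := w1 / w2, k := w2\<^sup>2 / w1,
                   l := U j * U k * U l / w2)"
    using *(2) by (auto simp: j_on_def Let_def w1_def w2_def split: if_splits)
  \<comment> \<open>With \<open>y = U / X\<close>, each product \<open>x * y\<close> in the last two
    denominators of \<open>J_map\<close> collapses to an entry of \<open>U\<close>, so they become
    \<open>z1\<close> and \<open>z2\<close> evaluated at \<open>U\<close>.\<close>
  have w1: "X i * (U i / X i) * (X j * (U j / X j) + X l * (U l / X l))\<^sup>2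
      + X k * (X l)\<^sup>2 * (U k / X k) * (U l / X l)\<^sup>2 = w1"
    and w2: "X i * (U i / X i) * (X j * (U j / X j) + X l * (U l / X l))
      + X k * X l * (U k / X k) * (U l / X l) = w2"
    using X(1-4) by (simp_all add: w1_def w2_def power_divide)
  have "J_map ((X i, U i / X i), (X j, U j / X j), (X k, U k / X k), (X l, U l / X l)) =
     Some ((X i * (X j)\<^sup>2 * X k / z1, (U i / X i) * (U j / X j)\<^sup>2 * (U k / X k) * z1 / w1),
           (z1 / z2, z2 * w1 / (z1 * w2)),
           (z2\<^sup>2 / z1, z1 * w2\<^sup>2 / (z2\<^sup>2 * w1)),
           (X j * X k * X l / z2, (U j / X j) * (U k / X k) * (U l / X l) * z2 / w2))"
    unfolding J_map_def Let_def prod.case w1 w2 z1_def[symmetric] z2_def[symmetric]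
    using X(5,6) U(5,6) by simp
  then show "J_on i j k l (join X U) = Some (join X' U')"
    using X(1-6) U(1-6) assms unfolding X(7) U(7)
    by (auto simp: act4_def join_def vec_eq_iff power_divide mult_ac)
qed

section \<open>The polynomials in the denominators\<close>

context
  fixes x :: "9 \<Rightarrow> complex"
begin

section \<open>Factors arising along the left-hand composite\<close>

text \<open>
  The formulas for \<open>p8\<close>, \<open>p10\<close>, \<open>p18\<close>, \<open>p17\<close> are the quotients of the right-hand sides of
  \<open>p1_p8\<close>, \<open>p6_p10\<close>, \<open>p11_p18\<close>, \<open>p13_p17\<close> below by the other factor.
\<close>

definition "p1 = x 4 + x 6"
definition "p2 = x 2 * p1 + x 4 * x 5"
definition "p3 = x 1 * p2 + x 3 * x 4 * x 5"
definition "p4 = x 1 * p2\<^sup>2 + x 3 * (x 4)\<^sup>2 * (x 5)\<^sup>2"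
definition "p5 = p1 * x 8 + x 5 * x 6"
definition "p6 = x 1 * (x 2)\<^sup>2 * x 3 * p1 * p5 + x 7 * x 8 * p4"
definition "p7 = x 1 * (x 2)\<^sup>2 * x 3 * p5\<^sup>2 + x 7 * (x 8)\<^sup>2 * p4"
definition "p8 = x 1 * (x 2)\<^sup>2 * x 3 * p5
  + x 7 * x 8 * (x 1 * p2 * (x 2 + x 5) + x 3 * x 4 * (x 5)\<^sup>2)"
definition "p9 = p6 + x 9 * p8"
definition "p10 = p4 + x 9 * (x 1 * p2 * (x 2 + x 5 + x 8) + x 3 * x 4 * x 5 * (x 5 + x 8))"

section \<open>Factors arising along the right-hand composite, some shared with the left\<close>

definition "p11 = x 4 + x 9"
definition "p12 = x 5 * p11 + x 8 * x 9"
definition "p13 = x 3 * p12 + x 7 * x 8 * x 9"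
definition "p14 = x 3 * p12\<^sup>2 + x 7 * (x 8)\<^sup>2 * (x 9)\<^sup>2"
definition "p15 = x 2 * p13 + x 5 * x 7 * x 8 * x 9"
definition "p16 = x 2 * x 6 * p13 + p11 * p15"
definition "p17 = x 2 * (x 4 + x 6 + x 9) + p12"
definition "p18 = x 2 * x 6 * (x 3 * p12 * (x 5 + x 8) + x 7 * (x 8)\<^sup>2 * x 9) + x 4 * x 8 * p15"
definition "p19 = x 1 * p17 + p13"
definition "p20 = x 1 * p17\<^sup>2 + p14"

lemmas p_defs = p1_def p2_def p3_def p4_def p5_def p6_def p7_def p8_def p9_def p10_def
  p11_def p12_def p13_def p14_def p15_def p16_def p17_def p18_def p19_def p20_def

section \<open>Factorizations of the sums\<close>

text \<open>In this and the next nine identities, a sum met in one of the composites has, over a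
  common denominator, a numerator that splits into two factors, one of which cancels. Here it is
  \<open>p1\<close>, at \<open>r_on 2 5 8\<close> on the left.\<close>

lemma p1_p8: "p1 * p8 = p6 + x 5 * x 6 * x 7 * x 8 * p3"
  unfolding p_defs by algebra

lemma p4_p19: "p3 * p10 + x 9 * p6 = p4 * p19"
  unfolding p_defs by algebra

lemma p13_p17: "p13 * p17 = p14 + p16"
  unfolding p_defs by algebra

lemma p11_p18: "p11 * p18 = x 2 * x 6 * p14 + x 4 * x 8 * p16"
  unfolding p_defs by algebra

lemma p3_p15: "x 2 * x 3 * x 4 * x 5 * p19 + x 9 * p8 = p3 * p15"
  unfolding p_defs by algebra

lemma p4_p20: "p10\<^sup>2 + (x 9)\<^sup>2 * p7 = p4 * p20"
  unfolding p_defs by algebra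

lemma p8_p16: "x 2 * x 3 * x 4 * (x 5)\<^sup>2 * x 6 * x 7 * x 8 * p19 + p9 * p15 = p8 * p16"
  unfolding p_defs by algebra

lemma p6_p10: "p6 * p10 = p4 * p9 + x 9 * p3 * p7"
  unfolding p_defs by algebra

lemma p9_p14: "x 1 * p16 * p18 + x 3 * x 4 * (x 5)\<^sup>2 * x 7 * x 8 * p11 * p20 = p9 * p14"
  unfolding p_defs by algebra

lemma p7_p14: "x 1 * p18\<^sup>2 + x 3 * (x 4)\<^sup>2 * (x 5)\<^sup>2 * x 7 * (x 8)\<^sup>2 * p20 = p7 * p14"
  unfolding p_defs by algebra

text \<open>Collects the coordinates and everything divided by. The factors \<open>p2\<close>,
  \<open>p5\<close>, \<open>p10\<close>, \<open>p12\<close>, \<open>p17\<close>, \<open>p18\<close>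
  are absent: they come only from the inner sum \<open>X j + X l\<close> of \<open>j_on\<close>,
  which may vanish.\<close>

definition "factor_product = x 1 * x 2 * x 3 * x 4 * x 5 * x 6 * x 7 * x 8 * x 9 *
  (p1 * p3 * p4 * p6 * p7 * p8 * p9 * p11 * p13 * p14 * p15 * p16 * p19 * p20)"

definition "endpoint = x(1 := x 1 * (x 2)\<^sup>2 * x 3 * (x 5)\<^sup>2 * (x 6)\<^sup>2 * x 7 / p7,
      2 := p7 / p9, 3 := p9\<^sup>2 / (p7 * p20),
      4 := x 2 * x 3 * x 4 * (x 5)\<^sup>2 * x 6 * x 7 * x 8 * p19 / (p8 * p15),
      5 := p8 * p20 / (p9 * p19), 6 := p9 / p8, 7 := p19\<^sup>2 / p20, 8 := p15 / p19,
      9 := x 5 * x 6 * x 7 * x 8 * x 9 / p15)"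

lemma nonzero_factors:
  assumes "factor_product \<noteq> 0"
  shows "x 1 \<noteq> 0" "x 2 \<noteq> 0" "x 3 \<noteq> 0" "x 4 \<noteq> 0" "x 5 \<noteq> 0" "x 6 \<noteq> 0" "x 7 \<noteq> 0"
    "x 8 \<noteq> 0" "x 9 \<noteq> 0" "p1 \<noteq> 0" "p3 \<noteq> 0" "p4 \<noteq> 0" "p6 \<noteq> 0" "p7 \<noteq> 0" "p8 \<noteq> 0"
    "p9 \<noteq> 0" "p19 \<noteq> 0" "p20 \<noteq> 0" "p15 \<noteq> 0" "p11 \<noteq> 0" "p13 \<noteq> 0" "p14 \<noteq> 0" "p16 \<noteq> 0"
  using assms by (auto simp: factor_product_def)

section \<open>A generic point followed through both composites\<close>

lemma scalar_left:
  assumes "factor_product \<noteq> 0"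
  shows "(r_on 4 8 9 \<circ>\<^sub>m j_on 3 5 7 9 \<circ>\<^sub>m r_on 2 6 9 \<circ>\<^sub>m r_on 2 5 8 \<circ>\<^sub>m
      j_on 1 6 7 8 \<circ>\<^sub>m j_on 1 2 3 4 \<circ>\<^sub>m r_on 4 5 6) x = Some endpoint"
proof -
  note [simp] = nonzero_factors[OF assms]
  define X1 where "X1 = x(4 := x 4 * x 5 / p1, 5 := p1, 6 := x 5 * x 6 / p1)"
  have s1: "r_on 4 5 6 x = Some X1"
    unfolding X1_def
  proof (rule r_on_eqI)
    show "x 4 = x 4" "x 5 = x 5" "x 6 = x 6"
      by simp_all
    show "x 4 + x 6 = p1"
      by (simp add: p1_def)
  qed (simp_all add: divide_simps power2_eq_square)
  define X2 where "X2 = X1(1 := x 1 * (x 2)\<^sup>2 * x 3 * p1\<^sup>2 / p4, 2 := p4 / (p1 * p3),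
      3 := p3\<^sup>2 / p4, 4 := x 2 * x 3 * x 4 * x 5 / p3)"
  have s2: "j_on 1 2 3 4 X1 = Some X2"
    unfolding X2_def
  proof (rule j_on_eqI)
    show "X1 1 = x 1" "X1 2 = x 2" "X1 3 = x 3" "X1 4 = x 4 * x 5 / p1"
      by (simp_all add: X1_def)
    \<comment> \<open>Clearing denominators leaves a polynomial equation that follows from the cited
      definition or factorization; all later sums are treated alike.\<close>
    show "x 2 + x 4 * x 5 / p1 = p2 / p1"
      by (simp add: divide_simps, use p2_def in algebra)
    show "x 1 * (p2 / p1)\<^sup>2 + x 3 * (x 4 * x 5 / p1)\<^sup>2 = p4 / p1\<^sup>2"
      by (simp add: divide_simps, use p4_def in algebra)
    show "x 1 * (p2 / p1) + x 3 * (x 4 * x 5 / p1) = p3 / p1"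
      by (simp add: divide_simps, use p3_def in algebra)
  qed (simp_all add: divide_simps power2_eq_square)
  define X3 where "X3 = X2(1 := x 1 * (x 2)\<^sup>2 * x 3 * (x 5)\<^sup>2 * (x 6)\<^sup>2 * x 7 / p7,
      6 := p7 / p6, 7 := p6\<^sup>2 / (p4 * p7), 8 := x 5 * x 6 * x 7 * x 8 * p4 / (p1 * p6))"
  have s3: "j_on 1 6 7 8 X2 = Some X3"
    unfolding X3_def
  proof (rule j_on_eqI)
    show "X2 1 = x 1 * (x 2)\<^sup>2 * x 3 * p1\<^sup>2 / p4" "X2 6 = x 5 * x 6 / p1"
      "X2 7 = x 7" "X2 8 = x 8"
      by (simp_all add: X1_def X2_def)
    show "x 5 * x 6 / p1 + x 8 = p5 / p1"
      by (simp add: divide_simps, use p5_def in algebra)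
    show "(x 1 * (x 2)\<^sup>2 * x 3 * p1\<^sup>2 / p4) * (p5 / p1)\<^sup>2 + x 7 * (x 8)\<^sup>2
      = p7 / p4"
      by (simp add: divide_simps, use p7_def in algebra)
    show "(x 1 * (x 2)\<^sup>2 * x 3 * p1\<^sup>2 / p4) * (p5 / p1) + x 7 * x 8 = p6 / p4"
      by (simp add: divide_simps, use p6_def in algebra)
  qed (simp_all add: divide_simps power2_eq_square)
  define X4 where "X4 = X3(2 := p6 / p8, 5 := p4 * p8 / (p3 * p6),
      8 := x 5 * x 6 * x 7 * x 8 * p3 / p8)"
  have s4: "r_on 2 5 8 X3 = Some X4"
    unfolding X4_def
  proof (rule r_on_eqI)
    show "X3 2 = p4 / (p1 * p3)" "X3 5 = p1" "X3 8 = x 5 * x 6 * x 7 * x 8 * p4 / (p1 * p6)"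
      by (simp_all add: X1_def X2_def X3_def)
    show "p4 / (p1 * p3) + x 5 * x 6 * x 7 * x 8 * p4 / (p1 * p6) = p4 * p8 / (p3 * p6)"
      by (simp add: divide_simps, use p1_p8 in algebra)
  qed (simp_all add: divide_simps power2_eq_square)
  define X5 where "X5 = X4(2 := p7 / p9, 6 := p9 / p8, 9 := x 9 * p7 * p8 / (p6 * p9))"
  have s5: "r_on 2 6 9 X4 = Some X5"
    unfolding X5_def
  proof (rule r_on_eqI)
    show "X4 2 = p6 / p8" "X4 6 = p7 / p6" "X4 9 = x 9"
      by (simp_all add: X1_def X2_def X3_def X4_def)
    show "p6 / p8 + x 9 = p9 / p8"
      by (simp add: divide_simps, use p9_def in algebra)
  qed (simp_all add: divide_simps power2_eq_square)
  define X6 where "X6 = X5(3 := p9\<^sup>2 / (p7 * p20), 5 := p8 * p20 / (p9 * p19),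
      7 := p19\<^sup>2 / p20, 9 := x 9 * p8 / (p3 * p19))"
  have s6: "j_on 3 5 7 9 X5 = Some X6"
    unfolding X6_def
  proof (rule j_on_eqI)
    show "X5 3 = p3\<^sup>2 / p4" "X5 5 = p4 * p8 / (p3 * p6)" "X5 7 = p6\<^sup>2 / (p4 * p7)"
      "X5 9 = x 9 * p7 * p8 / (p6 * p9)"
      by (simp_all add: X1_def X2_def X3_def X4_def X5_def)
    \<comment> \<open>Three factorizations meet in this map: \<open>p6\<close> cancels in the inner
      sum, and \<open>p4\<close> cancels in both \<open>z1\<close> and \<open>z2\<close>.\<close>
    show "p4 * p8 / (p3 * p6) + x 9 * p7 * p8 / (p6 * p9) = p8 * p10 / (p3 * p9)"
      by (simp add: divide_simps, use p6_p10 in algebra)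
    show "(p3\<^sup>2 / p4) * (p8 * p10 / (p3 * p9))\<^sup>2 + (p6\<^sup>2 / (p4 * p7)) * (x 9 * p7 * p8 / (p6 * p9))\<^sup>2
      = p8\<^sup>2 * p20 / p9\<^sup>2"
      by (simp add: divide_simps, use p4_p20 in algebra)
    show "(p3\<^sup>2 / p4) * (p8 * p10 / (p3 * p9)) + (p6\<^sup>2 / (p4 * p7)) * (x 9 * p7 * p8 / (p6 * p9))
      = p8 * p19 / p9"
      by (simp add: divide_simps, use p4_p19 in algebra)
  qed (simp_all add: divide_simps power2_eq_square)
  define X7 where "X7 = X6(4 := x 2 * x 3 * x 4 * (x 5)\<^sup>2 * x 6 * x 7 * x 8 * p19 / (p8 * p15),
      8 := p15 / p19, 9 := x 5 * x 6 * x 7 * x 8 * x 9 / p15)"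
  have s7: "r_on 4 8 9 X6 = Some X7"
    unfolding X7_def
  proof (rule r_on_eqI)
    show "X6 4 = x 2 * x 3 * x 4 * x 5 / p3" "X6 8 = x 5 * x 6 * x 7 * x 8 * p3 / p8"
      "X6 9 = x 9 * p8 / (p3 * p19)"
      by (simp_all add: X1_def X2_def X3_def X4_def X5_def X6_def)
    show "x 2 * x 3 * x 4 * x 5 / p3 + x 9 * p8 / (p3 * p19) = p15 / p19"
      by (simp add: divide_simps, use p3_p15 in algebra)
  qed (simp_all add: divide_simps power2_eq_square)
  \<comment> \<open>Each coordinate keeps the value given by the last map acting on it: 1 from
    \<open>X3\<close>, 2 and 6 from \<open>X5\<close>, 3, 5 and 7 from \<open>X6\<close>, and 4, 8
    and 9 from \<open>X7\<close>.\<close>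
  have "X7 = endpoint"
    by (rule ext) (simp add: endpoint_def X1_def X2_def X3_def X4_def X5_def X6_def X7_def)
  with s1 s2 s3 s4 s5 s6 s7 show ?thesis
    by simp
qed

text \<open>The first five maps involve only factors from \<open>p11\<close> to \<open>p20\<close>;
  the left-hand factors \<open>p7\<close>, \<open>p8\<close>, \<open>p9\<close> enter in the last
  two, which makes the endpoints comparable.\<close>

lemma scalar_right:
  assumes "factor_product \<noteq> 0"
  shows "(r_on 4 5 6 \<circ>\<^sub>m j_on 1 2 3 4 \<circ>\<^sub>m j_on 1 6 7 8 \<circ>\<^sub>m r_on 2 5 8 \<circ>\<^sub>m
      r_on 2 6 9 \<circ>\<^sub>m j_on 3 5 7 9 \<circ>\<^sub>m r_on 4 8 9) x = Some endpoint"
proof -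
  note [simp] = nonzero_factors[OF assms]
  define X1 where "X1 = x(4 := x 4 * x 8 / p11, 8 := p11, 9 := x 8 * x 9 / p11)"
  have s1: "r_on 4 8 9 x = Some X1"
    unfolding X1_def
  proof (rule r_on_eqI)
    show "x 4 = x 4" "x 8 = x 8" "x 9 = x 9"
      by simp_all
    show "x 4 + x 9 = p11"
      by (simp add: p11_def)
  qed (simp_all add: divide_simps power2_eq_square)
  define X2 where "X2 = X1(3 := x 3 * (x 5)\<^sup>2 * x 7 * p11\<^sup>2 / p14,
      5 := p14 / (p11 * p13), 7 := p13\<^sup>2 / p14, 9 := x 5 * x 7 * x 8 * x 9 / p13)"
  have s2: "j_on 3 5 7 9 X1 = Some X2"
    unfolding X2_def
  proof (rule j_on_eqI)
    show "X1 3 = x 3" "X1 5 = x 5" "X1 7 = x 7" "X1 9 = x 8 * x 9 / p11"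
      by (simp_all add: X1_def)
    show "x 5 + x 8 * x 9 / p11 = p12 / p11"
      by (simp add: divide_simps, use p12_def in algebra)
    show "x 3 * (p12 / p11)\<^sup>2 + x 7 * (x 8 * x 9 / p11)\<^sup>2 = p14 / p11\<^sup>2"
      by (simp add: divide_simps, use p14_def in algebra)
    show "x 3 * (p12 / p11) + x 7 * (x 8 * x 9 / p11) = p13 / p11"
      by (simp add: divide_simps, use p13_def in algebra)
  qed (simp_all add: divide_simps power2_eq_square)
  define X3 where "X3 = X2(2 := x 2 * x 6 * p13 / p15, 6 := p15 / p13,
      9 := x 5 * x 6 * x 7 * x 8 * x 9 / p15)"
  have s3: "r_on 2 6 9 X2 = Some X3"
    unfolding X3_def
  proof (rule r_on_eqI)
    show "X2 2 = x 2" "X2 6 = x 6" "X2 9 = x 5 * x 7 * x 8 * x 9 / p13"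
      by (simp_all add: X1_def X2_def)
    show "x 2 + x 5 * x 7 * x 8 * x 9 / p13 = p15 / p13"
      by (simp add: divide_simps, use p15_def in algebra)
  qed (simp_all add: divide_simps power2_eq_square)
  define X4 where "X4 = X3(2 := x 2 * x 6 * p14 / (p11 * p16), 5 := p16 / p15,
      8 := p15 * p14 / (p13 * p16))"
  have s4: "r_on 2 5 8 X3 = Some X4"
    unfolding X4_def
  proof (rule r_on_eqI)
    show "X3 2 = x 2 * x 6 * p13 / p15" "X3 5 = p14 / (p11 * p13)" "X3 8 = p11"
      by (simp_all add: X1_def X2_def X3_def)
    show "x 2 * x 6 * p13 / p15 + p11 = p16 / p15"
      by (simp add: divide_simps, use p16_def in algebra)
  qed (simp_all add: divide_simps power2_eq_square)
  define X5 where "X5 = X4(1 := x 1 * p16\<^sup>2 / (p20 * p14), 6 := p20 * p15 / (p19 * p16),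
      7 := p19\<^sup>2 / p20, 8 := p15 / p19)"
  have s5: "j_on 1 6 7 8 X4 = Some X5"
    unfolding X5_def
  proof (rule j_on_eqI)
    show "X4 1 = x 1" "X4 6 = p15 / p13" "X4 7 = p13\<^sup>2 / p14"
      "X4 8 = p15 * p14 / (p13 * p16)"
      by (simp_all add: X1_def X2_def X3_def X4_def)
    show "p15 / p13 + p15 * p14 / (p13 * p16) = p15 * p17 / p16"
      by (simp add: divide_simps, use p13_p17 in algebra)
    \<comment> \<open>Taking out \<open>(p15 / p16)^2\<close> here, and \<open>p15 / p16\<close> in
      the next sum, leaves exactly the defining expressions of \<open>p20\<close> and
      \<open>p19\<close>.\<close>
    show "x 1 * (p15 * p17 / p16)\<^sup>2 + (p13\<^sup>2 / p14) * (p15 * p14 / (p13 * p16))\<^sup>2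
      = p15\<^sup>2 * p20 / p16\<^sup>2"
      by (simp add: divide_simps, use p20_def in algebra)
    show "x 1 * (p15 * p17 / p16) + (p13\<^sup>2 / p14) * (p15 * p14 / (p13 * p16))
      = p15 * p19 / p16"
      by (simp add: divide_simps, use p19_def in algebra)
  qed (simp_all add: divide_simps power2_eq_square)
  define X6 where "X6 = X5(1 := x 1 * (x 2)\<^sup>2 * x 3 * (x 5)\<^sup>2 * (x 6)\<^sup>2 * x 7 / p7,
      2 := p7 / p9, 3 := p9\<^sup>2 / (p7 * p20),
      4 := x 2 * x 3 * x 4 * (x 5)\<^sup>2 * x 6 * x 7 * x 8 * p20 / (p9 * p16))"
  have s6: "j_on 1 2 3 4 X5 = Some X6"
    unfolding X6_def
  proof (rule j_on_eqI)
    show "X5 1 = x 1 * p16\<^sup>2 / (p20 * p14)" "X5 2 = x 2 * x 6 * p14 / (p11 * p16)"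
      "X5 3 = x 3 * (x 5)\<^sup>2 * x 7 * p11\<^sup>2 / p14" "X5 4 = x 4 * x 8 / p11"
      by (simp_all add: X1_def X2_def X3_def X4_def X5_def)
    show "x 2 * x 6 * p14 / (p11 * p16) + x 4 * x 8 / p11 = p18 / p16"
      by (simp add: divide_simps, use p11_p18 in algebra)
    \<comment> \<open>The factor \<open>p14\<close> cancels in \<open>z1\<close> and
      \<open>z2\<close>, and the quotients are the left-hand factors \<open>p7\<close> and
      \<open>p9\<close>.\<close>
    show "(x 1 * p16\<^sup>2 / (p20 * p14)) * (p18 / p16)\<^sup>2 + (x 3 * (x 5)\<^sup>2 * x 7 * p11\<^sup>2 / p14) * (x 4 * x 8 / p11)\<^sup>2
      = p7 / p20"
      by (simp add: divide_simps, use p7_p14 in algebra)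
    show "(x 1 * p16\<^sup>2 / (p20 * p14)) * (p18 / p16) + (x 3 * (x 5)\<^sup>2 * x 7 * p11\<^sup>2 / p14) * (x 4 * x 8 / p11)
      = p9 / p20"
      by (simp add: divide_simps, use p9_p14 in algebra)
  qed (simp_all add: divide_simps power2_eq_square)
  define X7 where "X7 = X6(4 := x 2 * x 3 * x 4 * (x 5)\<^sup>2 * x 6 * x 7 * x 8 * p19 / (p8 * p15),
      5 := p8 * p20 / (p9 * p19), 6 := p9 / p8)"
  have s7: "r_on 4 5 6 X6 = Some X7"
    unfolding X7_def
  proof (rule r_on_eqI)
    show "X6 4 = x 2 * x 3 * x 4 * (x 5)\<^sup>2 * x 6 * x 7 * x 8 * p20 / (p9 * p16)"
      "X6 5 = p16 / p15" "X6 6 = p20 * p15 / (p19 * p16)"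
      by (simp_all add: X1_def X2_def X3_def X4_def X5_def X6_def)
    show "x 2 * x 3 * x 4 * (x 5)\<^sup>2 * x 6 * x 7 * x 8 * p20 / (p9 * p16) + p20 * p15 / (p19 * p16)
      = p8 * p20 / (p9 * p19)"
      by (simp add: divide_simps, use p8_p16 in algebra)
  qed (simp_all add: divide_simps power2_eq_square)
  have "X7 = endpoint"
    by (rule ext) (simp add: endpoint_def X1_def X2_def X3_def X4_def X5_def X6_def X7_def)
  with s1 s2 s3 s4 s5 s6 s7 show ?thesis
    by simp
qed

end

section \<open>Polynomiality of the genericity condition\<close>

lemma polynomial_funs_square:
  "p \<in> polynomial_funs \<Longrightarrow> (\<lambda>v. (p v)\<^sup>2) \<in> polynomial_funs"
  unfolding power2_eq_square by (rule polynomial_funs.mult)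

text \<open>Stated for arbitrary polynomial coordinates because it serves both the functions
  \<open>x\<close> and the products \<open>x * y\<close>.\<close>

lemma polynomial_funs_factor_product:
  assumes "\<And>i. (\<lambda>v. f v i) \<in> polynomial_funs"
  shows "(\<lambda>v. factor_product (f v)) \<in> polynomial_funs"
  unfolding factor_product_def p_defs
  by (intro polynomial_funs.add polynomial_funs.mult polynomial_funs_square assms)

section \<open>The reflection equation\<close>

lemma exhaust_9:
  fixes i :: 9
  shows "i = 1 \<or> i = 2 \<or> i = 3 \<or> i = 4 \<or> i = 5 \<or> i = 6 \<or> i = 7 \<or> i = 8 \<or> i = 9"
proof (induct i)
  case (of_int z)
  \<comment> \<open>Representatives modulo 9 run from 0 to 8; the residue 0 is the index
    \<open>9\<close>.\<close>
  then have "z = 0 \<or> z = 1 \<or> z = 2 \<or> z = 3 \<or> z = 4 \<or> z = 5 \<or> z = 6 \<or> z = 7 \<or> z = 8"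
    by auto
  then show ?case
    by auto
qed

theorem proposition3p9:
  shows "rational_map_eq
    (R_on (4::9) 8 9 \<circ>\<^sub>m J_on 3 5 7 9 \<circ>\<^sub>m R_on 2 6 9 \<circ>\<^sub>m R_on 2 5 8 \<circ>\<^sub>m
     J_on 1 6 7 8 \<circ>\<^sub>m J_on 1 2 3 4 \<circ>\<^sub>m R_on 4 5 6)
    (R_on 4 5 6 \<circ>\<^sub>m J_on 1 2 3 4 \<circ>\<^sub>m J_on 1 6 7 8 \<circ>\<^sub>m R_on 2 5 8 \<circ>\<^sub>m
     R_on 2 6 9 \<circ>\<^sub>m J_on 3 5 7 9 \<circ>\<^sub>m R_on 4 8 9)"
    (is "rational_map_eq ?F ?G")
proof -
  define X :: "vec2 ^ 9 \<Rightarrow> 9 \<Rightarrow> complex" where "X v = (\<lambda>i. fst (v $ i))" for v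
  define U :: "vec2 ^ 9 \<Rightarrow> 9 \<Rightarrow> complex" where "U v = (\<lambda>i. fst (v $ i) * snd (v $ i))" for v
  \<comment> \<open>The scalar computation runs once on \<open>x\<close> and once on
    \<open>u = x * y\<close>, so both instances of the exceptional locus are removed.\<close>
  define q where "q v = factor_product (X v) * factor_product (U v)" for v
  have "q \<in> polynomial_funs"
    unfolding q_def[abs_def] X_def U_def
    by (intro polynomial_funs.mult polynomial_funs_factor_product
        polynomial_funs.coord_x polynomial_funs.coord_y)
  then have "zariski_open {v. q v \<noteq> 0}"
    unfolding zariski_open_def by (intro exI[of _ "{q}"]) auto
  \<comment> \<open>At this point all \<open>x\<close> and all \<open>u\<close> equal 1, and every
    factor is a sum of monomials with positive coefficients, hence a positive number.\<close>
  moreover have "q (\<chi> i. (1, 1)) \<noteq> 0"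
    by (simp add: q_def X_def U_def factor_product_def p_defs)
  then have "{v. q v \<noteq> 0} \<noteq> {}"
    by blast
  moreover have "?F v = Some (join (endpoint (X v)) (endpoint (U v)))
      \<and> ?G v = Some (join (endpoint (X v)) (endpoint (U v)))" if "q v \<noteq> 0" for v
  proof -
    have nz: "factor_product (X v) \<noteq> 0" "factor_product (U v) \<noteq> 0"
      using that by (auto simp: q_def)
    have "X v i \<noteq> 0" for i
      using nonzero_factors(1-9)[OF nz(1)] exhaust_9[of i] by auto
    then have v: "v = join (X v) (U v)"
      by (simp add: join_def X_def U_def vec_eq_iff)
    have F: "decouples ?F (r_on 4 8 9 \<circ>\<^sub>m j_on 3 5 7 9 \<circ>\<^sub>m r_on 2 6 9 \<circ>\<^sub>m r_on 2 5 8 \<circ>\<^sub>m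
        j_on 1 6 7 8 \<circ>\<^sub>m j_on 1 2 3 4 \<circ>\<^sub>m r_on 4 5 6)"
      and G: "decouples ?G (r_on 4 5 6 \<circ>\<^sub>m j_on 1 2 3 4 \<circ>\<^sub>m j_on 1 6 7 8 \<circ>\<^sub>m r_on 2 5 8 \<circ>\<^sub>m
        r_on 2 6 9 \<circ>\<^sub>m j_on 3 5 7 9 \<circ>\<^sub>m r_on 4 8 9)"
      by (intro decouples_comp decouples_r_on decouples_j_on; simp)+
    \<comment> \<open>The same scalar identity, applied to \<open>X v\<close> and to
      \<open>U v\<close>, gives the two halves of the image point.\<close>
    have "?F (join (X v) (U v)) = Some (join (endpoint (X v)) (endpoint (U v)))"
      using F scalar_left[OF nz(1)] scalar_left[OF nz(2)] unfolding decouples_def by blast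
    moreover have "?G (join (X v) (U v)) = Some (join (endpoint (X v)) (endpoint (U v)))"
      using G scalar_right[OF nz(1)] scalar_right[OF nz(2)] unfolding decouples_def by blast
    ultimately show ?thesis
      unfolding v[symmetric] ..
  qed
  ultimately show ?thesis
    unfolding rational_map_eq_def
    by (intro exI[of _ "{v. q v \<noteq> 0}"]) (auto simp: dom_def)
qed

end
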